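(* For every real $\epsilon>0$, the following greedy algorithm for IMA, with the sampling accuracy $\lambda>0$ and failure probability $\delta$ chosen sufficiently small depending on $\epsilon$, returns a set $S\subseteq (A\times V)\setminus E$ with $|S|\le k$ and $\sigma(A,S)\ge \left(1-\frac{1}{e}-\epsilon\right)\mathrm{OPT}$, where $\mathrm{OPT}=\max\{\sigma(A,S'):S'\subseteq (A\times V)\setminus E,\ |S'|\le k\}$. Algorithm: start with $S=\emptyset$; for $i=1,\dots,k$: for each $e\in (A\times V)\setminus(E\cup S)$, estimate $\sigma(A,S\cup\{e\})$ by repeated simulation of the diffusion process so that the estimate $\tilde\sigma(A,S\cup\{e\})$ is a $(1+\lambda)$-approximation with probability $1-\delta$; then add to $S$ an edge $\hat e$ maximizing $\tilde\sigma(A,S\cup\{e\})$; finally return $S$.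
   Context: A network is a directed graph $G=(V,E)$ with propagation probabilities $p:V\times V\to[0,1]$. Independent Cascade Model (ICM): given a seed set $A\subseteq V$, the nodes of $A$ are active at the start; each node $u$ that has just become active gets exactly one chance to activate each currently inactive out-neighbour $v$, succeeding independently with probability $p_{(u,v)}$; the process stops when no new node becomes active. For $S\subseteq (V\times V)\setminus E$, let $G(S)=(V,E\cup S)$ (new edges carry the probabilities given by $p$), and let $\sigma(A,S)$ be the expected number of active nodes at the end of the ICM process on $G(S)$ with seed set $A$. IMA (Influence Maximization with Augmentation): given $G$, $p$, $A\subseteq V$ and an integer $k$, find $S\subseteq (A\times V)\setminus E$ with $|S|\le k$ maximizing $\sigma(A,S)$.
   Formalization: As stated the bound cannot be certain, nor λ, δ depend on ε alone; here it holds with probability at least 1−η for any given η>0, where the threshold for λ depends on ε and k, and the one for δ also on η and a bound on |V|. *)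

theory Defs
  imports "HOL-Probability.Probability"
begin

definition network :: "'v set \<Rightarrow> ('v \<times> 'v) set \<Rightarrow> ('v \<times> 'v \<Rightarrow> real) \<Rightarrow> bool" where
  "network V E p \<longleftrightarrow> finite V \<and> E \<subseteq> V \<times> V \<and> (\<forall>e \<in> V \<times> V. 0 \<le> p e \<and> p e \<le> 1)"

text \<open>
  A state of the Independent Cascade process is a pair of the set of active nodes and the set of
  nodes that became active in the latest round. All activation attempts of a round are independent;
  an inactive node becomes active if at least one attempt on it succeeds.
\<close>

definition attempts :: "('v \<times> 'v) set \<Rightarrow> 'v set \<times> 'v set \<Rightarrow> ('v \<times> 'v) set" where
  "attempts E s = {(u, v) \<in> E. u \<in> snd s \<and> v \<notin> fst s}"

definition icm_round ::
  "('v \<times> 'v) set \<Rightarrow> ('v \<times> 'v \<Rightarrow> real) \<Rightarrow> 'v set \<times> 'v set \<Rightarrow> ('v set \<times> 'v set) pmf" where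
  "icm_round E p s =
     map_pmf (\<lambda>success. let N = snd ` {e \<in> attempts E s. success e} in (fst s \<union> N, N))
       (Pi_pmf (attempts E s) False (\<lambda>e. bernoulli_pmf (p e)))"

primrec icm_state ::
  "('v \<times> 'v) set \<Rightarrow> ('v \<times> 'v \<Rightarrow> real) \<Rightarrow> 'v set \<Rightarrow> nat \<Rightarrow> ('v set \<times> 'v set) pmf" where
  "icm_state E p A 0 = return_pmf (A, A)"
| "icm_state E p A (Suc t) = bind_pmf (icm_state E p A t) (icm_round E p)"

text \<open>
  Every round before the process stops activates a new node, so the process has stopped after
  \<open>card V\<close> rounds (lemma \<open>icm_stopped\<close>), and further rounds do not change the active set.
\<close>

definition icm ::
  "'v set \<Rightarrow> ('v \<times> 'v) set \<Rightarrow> ('v \<times> 'v \<Rightarrow> real) \<Rightarrow> 'v set \<Rightarrow> 'v set pmf" where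
  "icm V E p A = map_pmf fst (icm_state E p A (card V))"

lemma icm_round_support:
  assumes "finite E" "s' \<in> set_pmf (icm_round E p s)"
  shows "fst s' = fst s \<union> snd s'" "snd s' \<subseteq> snd ` E - fst s" "snd s = {} \<Longrightarrow> s' = (fst s, {})"
  using assms by (auto simp: icm_round_def attempts_def Let_def)

lemma icm_state_support:
  assumes "finite V" "E \<subseteq> V \<times> V" "A \<subseteq> V" "s \<in> set_pmf (icm_state E p A t)"
  shows "fst s \<subseteq> V \<and> (snd s = {} \<or> t < card (fst s))"
  using assms(4)
proof (induction t arbitrary: s)
  case 0
  with assms(1,3) show ?case by (auto simp: card_gt_0_iff finite_subset)
next
  case (Suc t)
  then obtain r where r: "r \<in> set_pmf (icm_state E p A t)" "s \<in> set_pmf (icm_round E p r)"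
    by auto
  have "finite E" using assms(1,2) finite_subset by blast
  note step = icm_round_support[OF this r(2)]
  note IH = Suc.IH[OF r(1)]
  have "snd ` E \<subseteq> V" using assms(2) by auto
  then have "fst s \<subseteq> V" using step(1,2) IH by blast
  moreover have "Suc t < card (fst s)" if "snd s \<noteq> {}"
  proof -
    have "snd r \<noteq> {}" using that step(3) by auto
    moreover have "fst r \<subset> fst s" using that step(1,2) by auto
    ultimately show ?thesis
      using IH \<open>fst s \<subseteq> V\<close> assms(1) psubset_card_mono[of "fst s" "fst r"] finite_subset by fastforce
  qed
  ultimately show ?case by blast
qed

lemma icm_stopped:
  assumes "finite V" "E \<subseteq> V \<times> V" "A \<subseteq> V" "s \<in> set_pmf (icm_state E p A (card V))"
  shows "snd s = {}"
  using icm_state_support[OF assms] assms(1) card_mono[of V "fst s"] by fastforce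

definition influence ::
  "'v set \<Rightarrow> ('v \<times> 'v) set \<Rightarrow> ('v \<times> 'v \<Rightarrow> real) \<Rightarrow> 'v set \<Rightarrow> ('v \<times> 'v) set \<Rightarrow> real" where
  "influence V E p A S = measure_pmf.expectation (icm V (E \<union> S) p A) (\<lambda>X. real (card X))"

definition feasible ::
  "'v set \<Rightarrow> ('v \<times> 'v) set \<Rightarrow> 'v set \<Rightarrow> nat \<Rightarrow> ('v \<times> 'v) set set" where
  "feasible V E A k = {S. S \<subseteq> A \<times> V - E \<and> card S \<le> k}"

definition OPT ::
  "'v set \<Rightarrow> ('v \<times> 'v) set \<Rightarrow> ('v \<times> 'v \<Rightarrow> real) \<Rightarrow> 'v set \<Rightarrow> nat \<Rightarrow> real" where
  "OPT V E p A k = Max (influence V E p A ` feasible V E A k)"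

text \<open>The average number of finally active nodes over \<open>r\<close> independent simulations.\<close>

definition estimate ::
  "'v set \<Rightarrow> ('v \<times> 'v) set \<Rightarrow> ('v \<times> 'v \<Rightarrow> real) \<Rightarrow> 'v set \<Rightarrow> nat \<Rightarrow> ('v \<times> 'v) set \<Rightarrow> real pmf" where
  "estimate V E p A r S =
     map_pmf (\<lambda>Xs. (\<Sum>X\<leftarrow>Xs. real (card X)) / real r) (replicate_pmf r (icm V (E \<union> S) p A))"

definition approximates :: "real \<Rightarrow> real \<Rightarrow> real \<Rightarrow> bool" where
  "approximates lam y x \<longleftrightarrow> x / (1 + lam) \<le> y \<and> y \<le> (1 + lam) * x"

text \<open>
  \<open>R T\<close> is the number of simulations used to estimate the influence of \<open>T\<close>. Only nonempty sets \<open>T\<close>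
  with at most \<open>k\<close> elements are ever evaluated by the algorithm.
\<close>

definition accurate_sampling ::
  "'v set \<Rightarrow> ('v \<times> 'v) set \<Rightarrow> ('v \<times> 'v \<Rightarrow> real) \<Rightarrow> 'v set \<Rightarrow> nat \<Rightarrow> real \<Rightarrow> real
    \<Rightarrow> (('v \<times> 'v) set \<Rightarrow> nat) \<Rightarrow> bool" where
  "accurate_sampling V E p A k lam \<delta> R \<longleftrightarrow>
     (\<forall>T \<in> feasible V E A k. T \<noteq> {} \<longrightarrow>
        measure_pmf.prob (estimate V E p A (R T) T) {y. approximates lam y (influence V E p A T)}
          \<ge> 1 - \<delta>)"

definition candidates ::
  "'v set \<Rightarrow> ('v \<times> 'v) set \<Rightarrow> 'v set \<Rightarrow> ('v \<times> 'v) set \<Rightarrow> ('v \<times> 'v) set" where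
  "candidates V E A S = A \<times> V - (E \<union> S)"

text \<open>
  \<open>pick S f\<close> is the candidate edge added to \<open>S\<close> when the computed estimates are \<open>f\<close>; it may break
  ties between maximizers in any way.
\<close>

definition maximizing_rule ::
  "'v set \<Rightarrow> ('v \<times> 'v) set \<Rightarrow> 'v set
    \<Rightarrow> (('v \<times> 'v) set \<Rightarrow> ('v \<times> 'v \<Rightarrow> real) \<Rightarrow> 'v \<times> 'v) \<Rightarrow> bool" where
  "maximizing_rule V E A pick \<longleftrightarrow>
     (\<forall>S f. candidates V E A S \<noteq> {} \<longrightarrow> is_arg_max f (\<lambda>e. e \<in> candidates V E A S) (pick S f))"

definition greedy_step ::
  "'v set \<Rightarrow> ('v \<times> 'v) set \<Rightarrow> ('v \<times> 'v \<Rightarrow> real) \<Rightarrow> 'v set \<Rightarrow> (('v \<times> 'v) set \<Rightarrow> nat)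
    \<Rightarrow> (('v \<times> 'v) set \<Rightarrow> ('v \<times> 'v \<Rightarrow> real) \<Rightarrow> 'v \<times> 'v)
    \<Rightarrow> ('v \<times> 'v) set \<Rightarrow> ('v \<times> 'v) set pmf" where
  "greedy_step V E p A R pick S =
     (if candidates V E A S = {} then return_pmf S
      else map_pmf (\<lambda>f. insert (pick S f) S)
        (Pi_pmf (candidates V E A S) 0
          (\<lambda>e. estimate V E p A (R (insert e S)) (insert e S))))"

primrec greedy ::
  "'v set \<Rightarrow> ('v \<times> 'v) set \<Rightarrow> ('v \<times> 'v \<Rightarrow> real) \<Rightarrow> 'v set \<Rightarrow> (('v \<times> 'v) set \<Rightarrow> nat)
    \<Rightarrow> (('v \<times> 'v) set \<Rightarrow> ('v \<times> 'v \<Rightarrow> real) \<Rightarrow> 'v \<times> 'v)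
    \<Rightarrow> nat \<Rightarrow> ('v \<times> 'v) set pmf" where
  "greedy V E p A R pick 0 = return_pmf {}"
| "greedy V E p A R pick (Suc i) =
     bind_pmf (greedy V E p A R pick i) (greedy_step V E p A R pick)"

end

theory Submission
  imports Defs
begin

text \<open>
  Flipping the coins of all edges in advance, the final active set becomes the set of nodes
  reachable from the seeds along live edges. Since every added edge starts in a seed, this set is
  the union of the nodes reached without added edges and of the nodes reached through each single
  added edge, so the influence is the expectation of a coverage function: monotone and submodular.
  If all estimates of a step are accurate, that step closes a \<open>1 / k\<close> fraction of the gap to the
  optimum up to a factor \<open>(1 + lam)\<^sup>2\<close>; a union bound over the at most \<open>k * n\<^sup>2\<close> estimates bounds
  the probability that some estimate is not accurate.
\<close>

section \<open>Cascade rounds driven by coins fixed in advance\<close>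

text \<open>One round as a deterministic function of the coins \<open>L\<close>. It reads
  \<open>L\<close> only on \<open>attempts E s\<close>, which is what allows all randomness to be
  drawn before the process starts.\<close>

definition live_round ::
  "('v \<times> 'v) set \<Rightarrow> ('v \<times> 'v \<Rightarrow> bool) \<Rightarrow> 'v set \<times> 'v set \<Rightarrow> 'v set \<times> 'v set" where
  "live_round E L s = (let N = snd ` {e \<in> attempts E s. L e} in (fst s \<union> N, N))"

lemma icm_round_eq_live_round:
  "icm_round E p s =
     map_pmf (\<lambda>L. live_round E L s) (Pi_pmf (attempts E s) False (\<lambda>e. bernoulli_pmf (p e)))"
  by (simp add: icm_round_def live_round_def)

lemma live_round_cong:
  assumes "\<And>e. e \<in> attempts E s \<Longrightarrow> L e = L' e"
  shows "live_round E L s = live_round E L' s"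
proof -
  have "{e \<in> attempts E s. L e} = {e \<in> attempts E s. L' e}" using assms by auto
  then show ?thesis by (simp add: live_round_def)
qed

lemma snd_live_round_subset: "snd (live_round E L s) \<subseteq> fst (live_round E L s)"
  by (auto simp: live_round_def Let_def)

text \<open>An edge that leaves an active node which is no longer newest, or that enters an active
  node, is never tried again, so its coin cannot affect the future. Such edges only accumulate from
  round to round, which makes the hypothesis an invariant.\<close>

lemma live_rounds_cong:
  assumes "snd s \<subseteq> fst s"
    and "\<And>u v. (u, v) \<in> E \<Longrightarrow> u \<notin> fst s - snd s \<Longrightarrow> v \<notin> fst s \<Longrightarrow> L (u, v) = L' (u, v)"
  shows "(live_round E L ^^ t) s = (live_round E L' ^^ t) s"
  using assms
proof (induction t arbitrary: s)
  case 0
  then show ?case by simp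
next
  case (Suc t)
  have eq: "live_round E L s = live_round E L' s"
    by (rule live_round_cong) (use Suc.prems(2) in \<open>auto simp: attempts_def\<close>)
  have "(live_round E L ^^ t) (live_round E L s) = (live_round E L' ^^ t) (live_round E L s)"
  proof (rule Suc.IH[OF snd_live_round_subset])
    fix u v
    assume "(u, v) \<in> E" "u \<notin> fst (live_round E L s) - snd (live_round E L s)"
      "v \<notin> fst (live_round E L s)"
    \<comment> \<open>New nodes were inactive before the round, so a node of \<open>fst s\<close>
      would now count as old. Hence \<open>u\<close> lies outside \<open>fst s\<close>
      altogether.\<close>
    then have "u \<notin> fst s - snd s" "v \<notin> fst s"
      by (auto simp: live_round_def Let_def attempts_def)
    with \<open>(u, v) \<in> E\<close> show "L (u, v) = L' (u, v)" by (rule Suc.prems(2))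
  qed
  then show ?case using eq by (simp add: funpow_Suc_right del: funpow.simps)
qed

text \<open>
  The principle of deferred decisions: after a round, the edges that have already been tried no
  longer matter, so all of them may be sampled afresh.
\<close>

lemma map_live_rounds_Suc:
  fixes p :: "'v \<times> 'v \<Rightarrow> real"
  assumes "finite D" "E \<subseteq> D" "snd s \<subseteq> fst s"
  defines "Q \<equiv> \<lambda>X. Pi_pmf X False (\<lambda>e. bernoulli_pmf (p e))"
  shows "map_pmf (\<lambda>L. (live_round E L ^^ Suc t) s) (Q D) =
    bind_pmf (icm_round E p s) (\<lambda>s'. map_pmf (\<lambda>L. (live_round E L ^^ t) s') (Q D))"
proof -
  define B where "B = attempts E s"
  define join where "join = (\<lambda>(f, g) e. if e \<in> B then f e else (g e :: bool))"
  have B: "B \<subseteq> D" using assms(2) by (auto simp: B_def attempts_def)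
  then have fin: "finite B" "finite (D - B)" using assms(1) finite_subset by auto
  have D: "D = B \<union> (D - B)" using B by auto
  have QD: "Q D = map_pmf join (pair_pmf (Q B) (Q (D - B)))"
    unfolding Q_def join_def by (subst D, subst Pi_pmf_union) (use fin in auto)
  have first: "live_round E (join (f, g)) s = live_round E f s" for f g
    by (rule live_round_cong) (simp add: join_def B_def)
  \<comment> \<open>Every edge of \<open>B\<close> starts in \<open>snd s\<close>, whose nodes are
    old after the round whatever coins \<open>h\<close> it used; hence the later rounds read only
    \<open>g\<close>.\<close>
  have rest: "(live_round E (join (f, g)) ^^ t) (live_round E h s)
      = (live_round E g ^^ t) (live_round E h s)" for f g h
  proof (rule live_rounds_cong[OF snd_live_round_subset])
    fix u v
    assume "(u, v) \<in> E" "u \<notin> fst (live_round E h s) - snd (live_round E h s)"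
      "v \<notin> fst (live_round E h s)"
    with assms(3) have "(u, v) \<notin> B"
      by (auto simp: live_round_def Let_def B_def attempts_def)
    then show "join (f, g) (u, v) = g (u, v)" by (simp add: join_def)
  qed
  have round: "icm_round E p s = map_pmf (\<lambda>L. live_round E L s) (Q B)"
    by (simp add: icm_round_eq_live_round B_def Q_def)
  have "map_pmf (\<lambda>L. (live_round E L ^^ Suc t) s) (Q D) =
      bind_pmf (Q B) (\<lambda>f. bind_pmf (Q (D - B)) (\<lambda>g.
        return_pmf ((live_round E g ^^ t) (live_round E f s))))"
    by (simp add: QD pair_pmf_def map_pmf_def bind_assoc_pmf bind_return_pmf funpow_Suc_right
        first rest del: funpow.simps)
  \<comment> \<open>In a fresh sample on all of \<open>D\<close>, the coins on \<open>B\<close> are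
    dropped by \<open>rest\<close>, so only the sample on \<open>D - B\<close> remains.\<close>
  also have "\<dots> = bind_pmf (icm_round E p s) (\<lambda>s'. map_pmf (\<lambda>L. (live_round E L ^^ t) s') (Q D))"
    by (simp add: QD round pair_pmf_def map_pmf_def bind_assoc_pmf bind_return_pmf rest)
  finally show ?thesis .
qed

text \<open>Deferred decisions, applied once per round, move all coin flips to the start.\<close>

lemma icm_state_eq_live_rounds:
  fixes p :: "'v \<times> 'v \<Rightarrow> real"
  assumes "finite D" "E \<subseteq> D"
  defines "Q \<equiv> Pi_pmf D False (\<lambda>e. bernoulli_pmf (p e))"
  shows "icm_state E p A t = map_pmf (\<lambda>L. (live_round E L ^^ t) (A, A)) Q"
proof -
  have E: "finite E" using assms(1,2) finite_subset by blast
  \<comment> \<open>Hybrid process: \<open>i\<close> true rounds followed by \<open>j\<close> rounds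
    on coins drawn in advance. Each induction step turns one precomputed round into a true one;
    \<open>i = 0\<close>, \<open>j = t\<close> is the claim.\<close>
  have "bind_pmf (icm_state E p A i) (\<lambda>s. map_pmf (\<lambda>L. (live_round E L ^^ j) s) Q)
      = icm_state E p A (i + j)" for i j
  proof (induction j arbitrary: i)
    case 0
    then show ?case by (simp add: map_pmf_const bind_return_pmf')
  next
    case (Suc j)
    have sub: "snd s \<subseteq> fst s" if "s \<in> set_pmf (icm_state E p A i)" for s
    proof (cases i)
      case 0
      then show ?thesis using that by simp
    next
      case (Suc m)
      then show ?thesis using that icm_round_support(1)[OF E] by fastforce
    qed
    have "bind_pmf (icm_state E p A i) (\<lambda>s. map_pmf (\<lambda>L. (live_round E L ^^ Suc j) s) Q)
        = bind_pmf (icm_state E p A i) (\<lambda>s. bind_pmf (icm_round E p s)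
            (\<lambda>s'. map_pmf (\<lambda>L. (live_round E L ^^ j) s') Q))"
      unfolding Q_def
      by (rule bind_pmf_cong[OF refl]) (rule map_live_rounds_Suc[OF assms(1,2) sub])
    also have "\<dots> = bind_pmf (icm_state E p A (Suc i)) (\<lambda>s. map_pmf (\<lambda>L. (live_round E L ^^ j) s) Q)"
      by (simp add: bind_assoc_pmf)
    also have "\<dots> = icm_state E p A (Suc i + j)" by (rule Suc.IH)
    finally show ?case by simp
  qed
  from this[of 0 t] show ?thesis by (simp add: bind_return_pmf)
qed

section \<open>The final active set as a reachable set\<close>

text \<open>Invariants of a breadth-first search along live edges. By the last one, old nodes have
  exhausted their live edges, so the active set is closed as soon as no node is newest.\<close>

lemma live_rounds_reachable:
  fixes E A L t
  defines "s \<equiv> (live_round E L ^^ t) (A, A)"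
  shows "A \<subseteq> fst s" "fst s \<subseteq> (E \<inter> Collect L)\<^sup>* `` A"
    "\<And>u v. (u, v) \<in> E \<inter> Collect L \<Longrightarrow> u \<in> fst s - snd s \<Longrightarrow> v \<in> fst s"
proof -
  \<comment> \<open>\<open>snd s \<subseteq> fst s\<close> is carried along to place the newest
    nodes in the reachable set.\<close>
  have "A \<subseteq> fst s \<and> fst s \<subseteq> (E \<inter> Collect L)\<^sup>* `` A \<and> snd s \<subseteq> fst s \<and>
    (\<forall>u v. (u, v) \<in> E \<inter> Collect L \<longrightarrow> u \<in> fst s - snd s \<longrightarrow> v \<in> fst s)"
    unfolding s_def
  proof (induction t)
    case 0
    show ?case by auto
  next
    case (Suc t)
    define r where "r = (live_round E L ^^ t) (A, A)"
    define N where "N = snd ` {e \<in> attempts E r. L e}"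
    have lr: "(live_round E L ^^ Suc t) (A, A) = (fst r \<union> N, N)"
      by (simp add: r_def[symmetric] live_round_def N_def)
    note IH = Suc.IH[folded r_def]
    have "N \<subseteq> (E \<inter> Collect L)\<^sup>* `` A"
    proof
      fix v assume "v \<in> N"
      then obtain u where "(u, v) \<in> E \<inter> Collect L" "u \<in> snd r"
        by (auto simp: N_def attempts_def)
      moreover from this(2) have "u \<in> (E \<inter> Collect L)\<^sup>* `` A" using IH by blast
      ultimately show "v \<in> (E \<inter> Collect L)\<^sup>* `` A"
        by (auto intro: rtrancl.rtrancl_into_rtrancl)
    qed
    \<comment> \<open>After the round, active nodes outside \<open>N\<close> lie in
      \<open>fst r\<close>. Those newest in \<open>r\<close> have just tried their inactive targets;
      older ones are covered by the induction hypothesis.\<close>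
    moreover have "v \<in> fst r \<union> N" if "(u, v) \<in> E \<inter> Collect L" "u \<in> fst r" for u v
    proof (cases "u \<in> snd r \<and> v \<notin> fst r")
      case True
      then have "(u, v) \<in> {e \<in> attempts E r. L e}" using that by (auto simp: attempts_def)
      then show ?thesis unfolding N_def by (metis UnI2 image_eqI snd_conv)
    next
      case False
      then show ?thesis using that IH by blast
    qed
    ultimately show ?case unfolding lr using IH by auto
  qed
  then show "A \<subseteq> fst s" "fst s \<subseteq> (E \<inter> Collect L)\<^sup>* `` A"
    "\<And>u v. (u, v) \<in> E \<inter> Collect L \<Longrightarrow> u \<in> fst s - snd s \<Longrightarrow> v \<in> fst s"
    by blast+
qed

text \<open>After \<open>card V\<close> rounds nothing is newest, so the active set contains
  \<open>A\<close>, lies in the reachable set and is closed under live edges. The coins cover all of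
  \<open>V \<times> V\<close> rather than \<open>E\<close> alone, so that every augmented graph uses
  the same coin distribution.\<close>

lemma icm_eq_reachable:
  assumes "finite V" "E \<subseteq> V \<times> V" "A \<subseteq> V"
  shows "icm V E p A = map_pmf (\<lambda>L. (E \<inter> Collect L)\<^sup>* `` A)
    (Pi_pmf (V \<times> V) False (\<lambda>e. bernoulli_pmf (p e)))"
proof -
  define Q where "Q = Pi_pmf (V \<times> V) False (\<lambda>e. bernoulli_pmf (p e))"
  have state: "icm_state E p A (card V) = map_pmf (\<lambda>L. (live_round E L ^^ card V) (A, A)) Q"
    unfolding Q_def by (rule icm_state_eq_live_rounds) (use assms in auto)
  have "fst ((live_round E L ^^ card V) (A, A)) = (E \<inter> Collect L)\<^sup>* `` A" if "L \<in> set_pmf Q" for L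
  proof -
    define s where "s = (live_round E L ^^ card V) (A, A)"
    have "s \<in> set_pmf (icm_state E p A (card V))" using that by (auto simp: state s_def)
    then have stop: "snd s = {}" by (rule icm_stopped[OF assms])
    note live = live_rounds_reachable[where A = A and t = "card V" and E = E and L = L, folded s_def]
    have "(E \<inter> Collect L) `` fst s \<subseteq> fst s" using live(3) stop by blast
    then have "(E \<inter> Collect L)\<^sup>* `` fst s = fst s" by (rule Image_closed_trancl)
    with live(1,2) show ?thesis unfolding s_def by blast
  qed
  then show ?thesis
    by (auto simp: icm_def state pmf.map_comp Q_def[symmetric] intro!: map_pmf_cong)
qed

section \<open>Live reachability as a coverage function of the added edges\<close>

definition live_reach ::
  "('v \<times> 'v) set \<Rightarrow> 'v set \<Rightarrow> ('v \<times> 'v \<Rightarrow> bool) \<Rightarrow> ('v \<times> 'v) set \<Rightarrow> 'v set" where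
  "live_reach E A L S = ((E \<union> S) \<inter> Collect L)\<^sup>* `` A"

lemma live_reach_mono: "S \<subseteq> T \<Longrightarrow> live_reach E A L S \<subseteq> live_reach E A L T"
  unfolding live_reach_def by (intro Image_mono rtrancl_mono) auto

lemma live_reach_subset:
  assumes "E \<subseteq> V \<times> V" "S \<subseteq> V \<times> V" "A \<subseteq> V"
  shows "live_reach E A L S \<subseteq> V"
proof -
  have "((E \<union> S) \<inter> Collect L)\<^sup>* `` V = V" by (rule Image_closed_trancl) (use assms in auto)
  then show ?thesis using assms(3) unfolding live_reach_def by blast
qed

lemma live_reach_step:
  "y \<in> live_reach E A L S \<Longrightarrow> (y, z) \<in> E \<union> S \<Longrightarrow> L (y, z) \<Longrightarrow> z \<in> live_reach E A L S"
  unfolding live_reach_def by (auto intro: rtrancl.rtrancl_into_rtrancl)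

lemma seed_in_live_reach: "a \<in> A \<Longrightarrow> a \<in> live_reach E A L S"
  unfolding live_reach_def by auto

text \<open>
  An added edge starts in a seed, so a path needs none of the edges before its last added edge.
\<close>

lemma live_reach_Un:
  assumes "T \<subseteq> A \<times> UNIV"
  shows "live_reach E A L (S \<union> T) = live_reach E A L S \<union> (\<Union>e\<in>T. live_reach E A L (insert e S))"
    (is "_ = ?R")
proof
  show "live_reach E A L (S \<union> T) \<subseteq> ?R"
  proof
    fix v assume "v \<in> live_reach E A L (S \<union> T)"
    then obtain a where a: "a \<in> A" "(a, v) \<in> ((E \<union> (S \<union> T)) \<inter> Collect L)\<^sup>*"
      unfolding live_reach_def by auto
    from a(2) show "v \<in> ?R"
    proof (induction rule: rtrancl_induct)
      case base
      show ?case using seed_in_live_reach[OF a(1)] by blast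
    next
      case (step y z)
      show ?case
      proof (cases "(y, z) \<in> T")
        case True
        then have "y \<in> live_reach E A L (insert (y, z) S)"
          using assms by (intro seed_in_live_reach) auto
        then have "z \<in> live_reach E A L (insert (y, z) S)"
          by (rule live_reach_step) (use step.hyps in auto)
        then show ?thesis using True by blast
      next
        case False
        then have yz: "(y, z) \<in> E \<union> S" "L (y, z)" using step.hyps by auto
        from step.IH consider "y \<in> live_reach E A L S"
          | e where "e \<in> T" "y \<in> live_reach E A L (insert e S)" by blast
        then show ?thesis
        proof cases
          case 1
          then show ?thesis using live_reach_step[OF 1 yz] by blast
        next
          case 2
          have "z \<in> live_reach E A L (insert e S)"
            by (rule live_reach_step[OF 2(2)]) (use yz in auto)
          then show ?thesis using 2(1) by blast
        qed
      qed
    qed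
  qed
  show "?R \<subseteq> live_reach E A L (S \<union> T)"
    by (intro Un_least UN_least live_reach_mono) auto
qed

text \<open>By \<open>live_reach_Un\<close> the gain of \<open>T\<close> over \<open>S\<close> is
  the union of the gains of its single edges, and cardinality is subadditive. This is the form of
  submodularity that the greedy analysis uses.\<close>

lemma card_live_reach_Un_le:
  assumes "finite V" "E \<subseteq> V \<times> V" "A \<subseteq> V" "S \<subseteq> A \<times> V" "T \<subseteq> A \<times> V"
  shows "real (card (live_reach E A L (S \<union> T))) \<le> real (card (live_reach E A L S)) +
    (\<Sum>e\<in>T. real (card (live_reach E A L (insert e S))) - real (card (live_reach E A L S)))"
proof -
  let ?c = "live_reach E A L"
  have sub: "?c X \<subseteq> V" if "X \<subseteq> A \<times> V" for X
    by (rule live_reach_subset) (use assms that in auto)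
  have fin: "finite (?c X)" if "X \<subseteq> A \<times> V" for X using sub[OF that] assms(1) finite_subset by blast
  have "finite T" using assms finite_subset finite_cartesian_product by metis
  have "?c (S \<union> T) = ?c S \<union> (\<Union>e\<in>T. ?c (insert e S) - ?c S)"
    using live_reach_Un[of T A E L S] assms(5) by blast
  then have "card (?c (S \<union> T)) \<le> card (?c S) + card (\<Union>e\<in>T. ?c (insert e S) - ?c S)"
    by (metis card_Un_le)
  also have "card (\<Union>e\<in>T. ?c (insert e S) - ?c S) \<le> (\<Sum>e\<in>T. card (?c (insert e S) - ?c S))"
    by (rule card_UN_le) fact
  finally have "card (?c (S \<union> T)) \<le> card (?c S) + (\<Sum>e\<in>T. card (?c (insert e S) - ?c S))"
    by simp
  then have "real (card (?c (S \<union> T)))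
      \<le> real (card (?c S) + (\<Sum>e\<in>T. card (?c (insert e S) - ?c S)))"
    by (rule of_nat_mono)
  also have "\<dots> = real (card (?c S)) + (\<Sum>e\<in>T. real (card (?c (insert e S) - ?c S)))" by simp
  also have "(\<Sum>e\<in>T. real (card (?c (insert e S) - ?c S)))
      = (\<Sum>e\<in>T. real (card (?c (insert e S))) - real (card (?c S)))"
  proof (rule sum.cong[OF refl])
    fix e assume "e \<in> T"
    have "?c S \<subseteq> ?c (insert e S)" by (rule live_reach_mono) auto
    moreover have "finite (?c (insert e S))" using fin assms(4,5) \<open>e \<in> T\<close> by auto
    ultimately show "real (card (?c (insert e S) - ?c S))
        = real (card (?c (insert e S))) - real (card (?c S))"
      by (simp add: card_Diff_subset finite_subset card_mono of_nat_diff)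
  qed
  finally show ?thesis by simp
qed

section \<open>Monotonicity and submodularity of the influence\<close>

lemma augmented_edges_subset:
  "network V E p \<Longrightarrow> A \<subseteq> V \<Longrightarrow> S \<subseteq> A \<times> V \<Longrightarrow> E \<union> S \<subseteq> V \<times> V"
  by (auto simp: network_def)

text \<open>Couples all augmentations on one coin space, so that inequalities valid for each
  \<open>L\<close> pass to the influence by monotonicity and linearity of expectation.\<close>

lemma influence_eq_expectation:
  assumes "network V E p" "A \<subseteq> V" "S \<subseteq> A \<times> V"
  shows "influence V E p A S = measure_pmf.expectation
    (Pi_pmf (V \<times> V) False (\<lambda>e. bernoulli_pmf (p e))) (\<lambda>L. real (card (live_reach E A L S)))"
proof -
  have "finite V" using assms(1) by (simp add: network_def)
  from icm_eq_reachable[OF this augmented_edges_subset[OF assms] assms(2)]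
  show ?thesis unfolding influence_def live_reach_def by simp
qed

text \<open>Coins outside \<open>V \<times> V\<close> are fixed to \<open>False\<close>, so the
  distribution has finite support.\<close>

lemma integrable_live:
  fixes g :: "('v \<times> 'v \<Rightarrow> bool) \<Rightarrow> real"
  assumes "finite V"
  shows "integrable (measure_pmf (Pi_pmf (V \<times> V) False (\<lambda>e. bernoulli_pmf (p e)))) g"
proof (rule integrable_measure_pmf_finite)
  have "set_pmf (Pi_pmf (V \<times> V) False (\<lambda>e. bernoulli_pmf (p e)))
      \<subseteq> PiE_dflt (V \<times> V) False (\<lambda>_. UNIV)"
    using assms by (auto simp: set_Pi_pmf PiE_dflt_def)
  moreover have "finite (PiE_dflt (V \<times> V) False (\<lambda>_. UNIV :: bool set))"
    using assms by (intro finite_PiE_dflt) auto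
  ultimately show "finite (set_pmf (Pi_pmf (V \<times> V) False (\<lambda>e. bernoulli_pmf (p e))))"
    by (rule finite_subset)
qed

lemma influence_nonneg: "0 \<le> influence V E p A S"
  unfolding influence_def by (rule Bochner_Integration.integral_nonneg) simp

lemma influence_mono:
  assumes "network V E p" "A \<subseteq> V" "T \<subseteq> A \<times> V" "S \<subseteq> T"
  shows "influence V E p A S \<le> influence V E p A T"
proof -
  have S: "S \<subseteq> A \<times> V" using assms by blast
  have V: "finite V" "E \<subseteq> V \<times> V" using assms(1) by (auto simp: network_def)
  have "card (live_reach E A L S) \<le> card (live_reach E A L T)" for L
  proof (rule card_mono)
    have "live_reach E A L T \<subseteq> V" by (rule live_reach_subset) (use V assms in auto)
    then show "finite (live_reach E A L T)" using V(1) finite_subset by blast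
  qed (rule live_reach_mono[OF assms(4)])
  then show ?thesis
    unfolding influence_eq_expectation[OF assms(1,2) S] influence_eq_expectation[OF assms(1-3)]
    by (intro integral_mono integrable_live V) simp
qed

lemma influence_Un_le:
  assumes "network V E p" "A \<subseteq> V" "S \<subseteq> A \<times> V" "T \<subseteq> A \<times> V"
  shows "influence V E p A (S \<union> T) \<le> influence V E p A S +
    (\<Sum>e\<in>T. influence V E p A (insert e S) - influence V E p A S)"
proof -
  let ?Q = "Pi_pmf (V \<times> V) False (\<lambda>e. bernoulli_pmf (p e))"
  let ?c = "\<lambda>L S. real (card (live_reach E A L S))"
  have V: "finite V" "E \<subseteq> V \<times> V" using assms(1) by (auto simp: network_def)
  have I: "influence V E p A X = measure_pmf.expectation ?Q (\<lambda>L. ?c L X)" if "X \<subseteq> A \<times> V" for X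
    by (rule influence_eq_expectation[OF assms(1,2) that])
  have "influence V E p A (S \<union> T) = measure_pmf.expectation ?Q (\<lambda>L. ?c L (S \<union> T))"
    using assms by (intro I) auto
  also have "\<dots> \<le> measure_pmf.expectation ?Q
      (\<lambda>L. ?c L S + (\<Sum>e\<in>T. ?c L (insert e S) - ?c L S))"
    by (intro integral_mono integrable_live card_live_reach_Un_le[OF V assms(2-4)] V)
  also have "\<dots> = measure_pmf.expectation ?Q (\<lambda>L. ?c L S) + (\<Sum>e\<in>T.
      measure_pmf.expectation ?Q (\<lambda>L. ?c L (insert e S)) - measure_pmf.expectation ?Q (\<lambda>L. ?c L S))"
    by (simp add: integrable_live V)
  also have "\<dots> = influence V E p A S +
      (\<Sum>e\<in>T. influence V E p A (insert e S) - influence V E p A S)"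
    using assms(3,4) by (auto simp: I intro!: sum.cong)
  finally show ?thesis .
qed

section \<open>The optimum and the progress of one greedy step\<close>

lemma finite_feasible:
  assumes "network V E p" "A \<subseteq> V"
  shows "finite (feasible V E A k)"
proof -
  have "finite (A \<times> V)" using assms finite_subset by (auto simp: network_def)
  then have "finite (Pow (A \<times> V))" by simp
  then show ?thesis by (rule rev_finite_subset) (auto simp: feasible_def)
qed

lemma OPT_attained:
  assumes "network V E p" "A \<subseteq> V"
  obtains T where "T \<in> feasible V E A k" "OPT V E p A k = influence V E p A T"
proof -
  have "{} \<in> feasible V E A k" by (simp add: feasible_def)
  then have "OPT V E p A k \<in> influence V E p A ` feasible V E A k"
    unfolding OPT_def by (intro Max_in) (use finite_feasible[OF assms] in auto)
  then show ?thesis using that by blast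
qed

text \<open>Adding an optimal set to \<open>S\<close> brings at most \<open>k\<close> new edges,
  each gaining at most \<open>M - influence V E p A S\<close>, and submodularity sums these gains.
  \<open>M\<close> is a free upper bound so that it can absorb estimation errors, and it may equal
  the influence of \<open>S\<close> when no candidate is left.\<close>

lemma OPT_le_of_candidates_bounded:
  assumes "network V E p" "A \<subseteq> V" "S \<subseteq> A \<times> V - E"
    and M: "influence V E p A S \<le> M"
      "\<And>e. e \<in> candidates V E A S \<Longrightarrow> influence V E p A (insert e S) \<le> M"
  shows "OPT V E p A k \<le> influence V E p A S + real k * (M - influence V E p A S)"
proof -
  let ?f = "influence V E p A"
  obtain T where T: "T \<subseteq> A \<times> V - E" "card T \<le> k" "OPT V E p A k = ?f T"
    using OPT_attained[OF assms(1,2)] unfolding feasible_def by blast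
  have "finite (A \<times> V)" using assms(1,2) finite_subset by (auto simp: network_def)
  then have fin: "finite T" using T(1) finite_subset by blast
  have sub: "S \<subseteq> A \<times> V" "T - S \<subseteq> A \<times> V" using assms(3) T(1) by auto
  have "?f T \<le> ?f (S \<union> (T - S))"
    by (rule influence_mono[OF assms(1,2)]) (use sub in auto)
  also have "\<dots> \<le> ?f S + (\<Sum>e\<in>T - S. ?f (insert e S) - ?f S)"
    by (rule influence_Un_le[OF assms(1,2) sub])
  also have "(\<Sum>e\<in>T - S. ?f (insert e S) - ?f S) \<le> (\<Sum>e\<in>T - S. M - ?f S)"
    using T(1) by (intro sum_mono diff_right_mono M(2)) (auto simp: candidates_def)
  also have "\<dots> = real (card (T - S)) * (M - ?f S)" by simp
  also have "\<dots> \<le> real k * (M - ?f S)"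
    using M(1) T(2) card_mono[OF fin, of "T - S"] by (intro mult_right_mono) auto
  finally show ?thesis using T(3) by simp
qed

text \<open>Selecting by estimates costs the factor \<open>1 + lam\<close> twice: the best candidate
  may be underestimated and the chosen edge overestimated.\<close>

lemma greedy_step_improves:
  fixes lam :: real and k :: nat
  assumes net: "network V E p" "A \<subseteq> V" "S \<subseteq> A \<times> V - E"
    and "0 < k" "0 < lam" "candidates V E A S \<noteq> {}" "maximizing_rule V E A pick"
    and est: "\<And>e. e \<in> candidates V E A S \<Longrightarrow> approximates lam (f e) (influence V E p A (insert e S))"
  shows "((1 - 1 / k) * influence V E p A S + OPT V E p A k / k) / (1 + lam)\<^sup>2
    \<le> influence V E p A (insert (pick S f) S)"
proof -
  let ?f = "influence V E p A"
  define d where "d = pick S f"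
  define M where "M = (1 + lam)\<^sup>2 * ?f (insert d S)"
  have "is_arg_max f (\<lambda>e. e \<in> candidates V E A S) d"
    using assms(6,7) by (simp add: maximizing_rule_def d_def)
  then have d: "d \<in> candidates V E A S" "\<And>e. e \<in> candidates V E A S \<Longrightarrow> f e \<le> f d"
    by (auto simp: is_arg_max_linorder)
  have bound: "?f (insert e S) \<le> M" if "e \<in> candidates V E A S" for e
  proof -
    have "?f (insert e S) / (1 + lam) \<le> f e" using est[OF that] by (simp add: approximates_def)
    also have "\<dots> \<le> f d" by (rule d(2)[OF that])
    also have "\<dots> \<le> (1 + lam) * ?f (insert d S)"
      using est[OF d(1)] by (simp add: approximates_def)
    finally show ?thesis using assms(5) by (simp add: M_def field_simps power2_eq_square)
  qed
  have "?f S \<le> ?f (insert d S)"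
    using net d(1) by (intro influence_mono) (auto simp: candidates_def)
  with bound[OF d(1)] have "?f S \<le> M" by simp
  from OPT_le_of_candidates_bounded[OF net this bound, of k]
  have "(1 - 1 / k) * ?f S + OPT V E p A k / k \<le> M" using assms(4) by (simp add: field_simps)
  then show ?thesis using assms(5) by (simp add: M_def d_def field_simps)
qed

lemma greedy_feasible:
  assumes "maximizing_rule V E A pick" "S \<in> set_pmf (greedy V E p A R pick i)"
  shows "S \<subseteq> A \<times> V - E \<and> card S \<le> i"
  using assms(2)
proof (induction i arbitrary: S)
  case 0
  then show ?case by simp
next
  case (Suc i)
  then obtain S' where S': "S' \<in> set_pmf (greedy V E p A R pick i)"
      "S \<in> set_pmf (greedy_step V E p A R pick S')" by auto
  note IH = Suc.IH[OF S'(1)]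
  show ?case
  proof (cases "candidates V E A S' = {}")
    case True
    then show ?thesis using S'(2) IH by (simp add: greedy_step_def)
  next
    case False
    then obtain f where S: "S = insert (pick S' f) S'"
      using S'(2) by (auto simp: greedy_step_def)
    have "pick S' f \<in> candidates V E A S'"
      using assms(1) False by (auto simp: maximizing_rule_def is_arg_max_def)
    moreover have "card S \<le> Suc (card S')" unfolding S by (rule card_insert_le_m1) auto
    ultimately show ?thesis using IH S by (auto simp: candidates_def)
  qed
qed

section \<open>Union bounds for failure probabilities\<close>

text \<open>Conditions on the first stage: outside \<open>G\<close> the probability of
  \<open>B\<close> is bounded by 1, inside \<open>G\<close> by \<open>c\<close>.\<close>

lemma prob_bind_pmf_le:
  assumes "0 \<le> c" "\<And>x. x \<in> set_pmf M \<Longrightarrow> x \<in> G \<Longrightarrow> measure_pmf.prob (K x) B \<le> c"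
  shows "measure_pmf.prob (bind_pmf M K) B \<le> measure_pmf.prob M (- G) + c"
proof -
  have int: "integrable (measure_pmf M) (\<lambda>x. measure_pmf.prob (K x) B)"
    by (rule measure_pmf.integrable_const_bound[where B = 1]) auto
  have "ennreal (measure_pmf.prob (bind_pmf M K) B)
      = (\<integral>\<^sup>+ x. ennreal (measure_pmf.prob (K x) B) \<partial>measure_pmf M)"
    by (simp flip: measure_pmf.emeasure_eq_measure)
  also have "\<dots> = ennreal (measure_pmf.expectation M (\<lambda>x. measure_pmf.prob (K x) B))"
    using int by (rule nn_integral_eq_integral) simp
  finally have "measure_pmf.prob (bind_pmf M K) B
      = measure_pmf.expectation M (\<lambda>x. measure_pmf.prob (K x) B)"
    by (subst (asm) ennreal_inj) (auto intro: Bochner_Integration.integral_nonneg)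
  also have "\<dots> \<le> measure_pmf.expectation M (\<lambda>x. indicator (- G) x + c)"
  proof (rule integral_mono_AE[OF int])
    show "AE x in measure_pmf M. measure_pmf.prob (K x) B \<le> indicator (- G) x + c"
      using assms(1) assms(2) measure_pmf.prob_le_1
      by (auto simp: AE_measure_pmf_iff indicator_def intro: add_increasing2)
  qed (auto intro!: integrable_real_indicator simp: measure_pmf.emeasure_eq_measure)
  also have "\<dots> = measure_pmf.prob M (- G) + c"
    by (subst Bochner_Integration.integral_add)
      (auto intro!: integrable_real_indicator simp: measure_pmf.emeasure_eq_measure)
  finally show ?thesis .
qed

text \<open>Union bound over the coordinates; coordinate \<open>e\<close> of the product has
  marginal \<open>q e\<close>.\<close>

lemma prob_Pi_pmf_union_bound:
  fixes d :: real
  assumes "finite C" "\<And>e. e \<in> C \<Longrightarrow> measure_pmf.prob (q e) {y. \<not> P e y} \<le> d"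
  shows "measure_pmf.prob (Pi_pmf C z q) {f. \<exists>e\<in>C. \<not> P e (f e)} \<le> card C * d"
proof -
  let ?Q = "Pi_pmf C z q"
  have "{f. \<exists>e\<in>C. \<not> P e (f e)} = (\<Union>e\<in>C. {f. \<not> P e (f e)})" by auto
  then have "measure_pmf.prob ?Q {f. \<exists>e\<in>C. \<not> P e (f e)}
      \<le> (\<Sum>e\<in>C. measure_pmf.prob ?Q {f. \<not> P e (f e)})"
    using measure_pmf.finite_measure_subadditive_finite[OF assms(1), of "\<lambda>e. {f. \<not> P e (f e)}" ?Q]
    by simp
  also have "\<dots> \<le> (\<Sum>e\<in>C. d)"
  proof (rule sum_mono)
    fix e assume e: "e \<in> C"
    have "measure_pmf.prob ?Q {f. \<not> P e (f e)}
        = measure_pmf.prob (map_pmf (\<lambda>f. f e) ?Q) {y. \<not> P e y}"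
      by (simp add: vimage_def)
    also have "map_pmf (\<lambda>f. f e) ?Q = q e" using e assms(1) by (simp add: Pi_pmf_component)
    finally show "measure_pmf.prob ?Q {f. \<not> P e (f e)} \<le> d" using assms(2)[OF e] by simp
  qed
  finally show ?thesis by simp
qed

lemma OPT_nonneg:
  assumes "network V E p" "A \<subseteq> V"
  shows "0 \<le> OPT V E p A k"
  using OPT_attained[OF assms, of k] influence_nonneg by metis

section \<open>The approximation ratio given by the recursion\<close>

text \<open>
  Solves the recursion \<open>b (i + 1) = c * ((1 - 1 / k) * b i + 1 / k)\<close> from below,
  where \<open>c = 1 / (1 + lam)\<^sup>2\<close> is the loss per step due to estimation errors.
\<close>

definition greedy_ratio :: "real \<Rightarrow> nat \<Rightarrow> nat \<Rightarrow> real" where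
  "greedy_ratio lam k i = (1 - (1 - 1 / k) ^ i) / ((1 + lam)\<^sup>2) ^ i"

lemma greedy_ratio_Suc_le:
  assumes "0 < lam" "0 < k"
  shows "greedy_ratio lam k (Suc i) \<le> ((1 - 1 / k) * greedy_ratio lam k i + 1 / k) / (1 + lam)\<^sup>2"
proof -
  define a where "a = (1 + lam)\<^sup>2"
  define q where "q = 1 - 1 / real k"
  have a: "1 \<le> a" using assms by (simp add: a_def)
  then have ai: "1 \<le> a ^ i" by simp
  \<comment> \<open>The inequality enters here: the closed form also divides the additive term
    \<open>1 - q = 1 / k\<close> by \<open>a ^ i\<close>, which only lowers it.\<close>
  have "(1 - q) / a ^ i \<le> 1 - q"
    using ai assms by (simp add: q_def field_simps)
  moreover have "(1 - q ^ Suc i) / a ^ i = q * ((1 - q ^ i) / a ^ i) + (1 - q) / a ^ i"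
    by (simp add: algebra_simps flip: add_divide_distrib)
  ultimately have "(1 - q ^ Suc i) / a ^ i \<le> q * ((1 - q ^ i) / a ^ i) + (1 - q)" by simp
  then have "(1 - q ^ Suc i) / a ^ i / a \<le> (q * ((1 - q ^ i) / a ^ i) + (1 - q)) / a"
    using a by (intro divide_right_mono) auto
  then show ?thesis by (simp add: greedy_ratio_def a_def[symmetric] q_def mult.commute)
qed

text \<open>Serves the case that the candidates run out: the current set then reaches
  \<open>OPT\<close>, which must suffice for the claimed ratio.\<close>

lemma greedy_ratio_le_1:
  assumes "0 < lam" "0 < k"
  shows "greedy_ratio lam k i \<le> 1"
proof -
  have "0 \<le> (1 - 1 / real k) ^ i" using assms by simp
  moreover have "1 \<le> ((1 + lam)\<^sup>2) ^ i" using assms by (intro one_le_power) simp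
  ultimately show ?thesis unfolding greedy_ratio_def by (subst divide_le_eq_1) linarith
qed

text \<open>Two losses are separated: \<open>(1 - 1 / k) ^ k \<le> 1 / exp 1\<close> from the greedy
  choice, and \<open>1 / (1 + lam) ^ (2 * k) \<ge> 1 - \<epsilon>\<close> from sampling.\<close>

lemma greedy_ratio_ge:
  assumes "0 < lam" "0 < k" "2 * k * lam \<le> \<epsilon>"
  shows "1 - 1 / exp 1 - \<epsilon> \<le> greedy_ratio lam k k"
proof -
  define x where "x = (1 - 1 / real k) ^ k"
  have "(1 - 1 / real k) ^ k \<le> exp (- (1 / real k)) ^ k"
    using assms exp_ge_add_one_self[of "- (1 / real k)"] by (intro power_mono) auto
  also have "\<dots> = 1 / exp 1"
    using assms by (simp flip: exp_of_nat_mult) (simp add: exp_minus inverse_eq_divide)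
  finally have x: "x \<le> 1 / exp 1" by (simp add: x_def)
  \<comment> \<open>Both bounds come from \<open>1 + t \<le> exp t\<close>, at
    \<open>t = lam\<close> and at \<open>t = - (2 * k * lam)\<close>.\<close>
  have "1 - 2 * k * lam \<le> 1 / (1 + lam) ^ (2 * k)"
  proof -
    have "1 + lam \<le> exp lam" by (rule exp_ge_add_one_self)
    then have "(1 + lam) ^ (2 * k) \<le> exp lam ^ (2 * k)" using assms by (intro power_mono) auto
    also have "\<dots> = exp (2 * k * lam)" by (simp flip: exp_of_nat_mult)
    finally have "1 / exp (2 * k * lam) \<le> 1 / (1 + lam) ^ (2 * k)"
      using assms by (intro divide_left_mono) auto
    moreover have "1 - 2 * k * lam \<le> 1 / exp (2 * k * lam)"
      using exp_ge_add_one_self[of "- (2 * k * lam)"] by (simp add: exp_minus inverse_eq_divide)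
    ultimately show ?thesis by linarith
  qed
  then have c: "1 - \<epsilon> \<le> 1 / ((1 + lam)\<^sup>2) ^ k" using assms(3) by (simp add: power_mult)
  \<comment> \<open>As \<open>y\<close> lies between 0 and 1, multiplying it by
    \<open>1 - \<epsilon>\<close> costs at most \<open>\<epsilon>\<close>.\<close>
  define y where "y = 1 - 1 / exp (1 :: real)"
  have y: "0 \<le> y" "y \<le> 1" by (auto simp: y_def)
  have "0 \<le> 2 * k * lam" using assms(1) by simp
  then have "0 \<le> \<epsilon>" using assms(3) by linarith
  then have "\<epsilon> * y \<le> \<epsilon>" using y by (simp add: mult_left_le)
  then have "y - \<epsilon> \<le> y * (1 - \<epsilon>)" by (simp add: algebra_simps)
  also have "\<dots> \<le> y * (1 / ((1 + lam)\<^sup>2) ^ k)"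
    by (rule mult_left_mono[OF c y(1)])
  also have "\<dots> \<le> (1 - x) * (1 / ((1 + lam)\<^sup>2) ^ k)"
    using x by (intro mult_right_mono) (auto simp: y_def)
  finally show ?thesis by (simp add: greedy_ratio_def x_def y_def)
qed

section \<open>Failure probability of the greedy algorithm\<close>

text \<open>The step can fail only if some candidate is estimated inaccurately, and there are at
  most \<open>card V ^ 2\<close> candidates, each bad with probability at most
  \<open>\<delta>\<close>.\<close>

lemma prob_greedy_step_fails:
  assumes net: "network V E p" "A \<subseteq> V" "S \<subseteq> A \<times> V - E" "card S < k"
    and lam: "0 < lam" "0 < \<delta>" and samp: "accurate_sampling V E p A k lam \<delta> R"
    and pick: "maximizing_rule V E A pick"
    and S: "greedy_ratio lam k i * OPT V E p A k \<le> influence V E p A S"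
  shows "measure_pmf.prob (greedy_step V E p A R pick S)
      {T. \<not> greedy_ratio lam k (Suc i) * OPT V E p A k \<le> influence V E p A T} \<le> real (card V ^ 2) * \<delta>"
proof (cases "candidates V E A S = {}")
  case True
  \<comment> \<open>Without candidates, \<open>M\<close> may be the influence of \<open>S\<close>
    itself, so the term with factor \<open>k\<close> vanishes.\<close>
  then have "OPT V E p A k \<le> influence V E p A S"
    using OPT_le_of_candidates_bounded[OF net(1-3) order.refl, of k] by simp
  moreover have "greedy_ratio lam k (Suc i) * OPT V E p A k \<le> OPT V E p A k"
    using mult_right_mono[OF greedy_ratio_le_1 OPT_nonneg[OF net(1,2)]] lam net(4) by force
  ultimately show ?thesis using True lam by (simp add: greedy_step_def)
next
  case False
  let ?f = "influence V E p A" and ?C = "candidates V E A S"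
  let ?est = "\<lambda>e. estimate V E p A (R (insert e S)) (insert e S)"
  have k: "0 < k" using net(4) by simp
  have V: "finite V" using net(1) by (simp add: network_def)
  have "?C \<subseteq> V \<times> V" using net(2) by (auto simp: candidates_def)
  then have C: "finite ?C" "card ?C \<le> card V ^ 2"
    using V card_mono[of "V \<times> V" ?C] by (auto simp: finite_subset card_cartesian_product power2_eq_square)
  have "greedy_ratio lam k (Suc i) * OPT V E p A k \<le> ?f (insert (pick S f) S)"
    if "\<And>e. e \<in> ?C \<Longrightarrow> approximates lam (f e) (?f (insert e S))" for f
  proof -
    have "greedy_ratio lam k (Suc i) * OPT V E p A k
        \<le> ((1 - 1 / k) * greedy_ratio lam k i + 1 / k) / (1 + lam)\<^sup>2 * OPT V E p A k"
      by (rule mult_right_mono[OF greedy_ratio_Suc_le[OF lam(1) k] OPT_nonneg[OF net(1,2)]])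
    also have "\<dots> = ((1 - 1 / k) * (greedy_ratio lam k i * OPT V E p A k) + OPT V E p A k / k)
        / (1 + lam)\<^sup>2"
      by (simp add: algebra_simps add_divide_distrib diff_divide_distrib)
    also have "\<dots> \<le> ((1 - 1 / k) * ?f S + OPT V E p A k / k) / (1 + lam)\<^sup>2"
      using S k by (intro divide_right_mono add_right_mono mult_left_mono) auto
    also have "\<dots> \<le> ?f (insert (pick S f) S)"
      by (rule greedy_step_improves[OF net(1-3) k lam(1) False pick that])
    finally show ?thesis .
  qed
  then have "{f. \<not> greedy_ratio lam k (Suc i) * OPT V E p A k \<le> ?f (insert (pick S f) S)}
      \<subseteq> {f. \<exists>e\<in>?C. \<not> approximates lam (f e) (?f (insert e S))}" by blast
  then have "measure_pmf.prob (greedy_step V E p A R pick S)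
      {T. \<not> greedy_ratio lam k (Suc i) * OPT V E p A k \<le> ?f T}
      \<le> measure_pmf.prob (Pi_pmf ?C 0 ?est) {f. \<exists>e\<in>?C. \<not> approximates lam (f e) (?f (insert e S))}"
    using False by (auto simp: greedy_step_def vimage_def intro!: measure_pmf.finite_measure_mono)
  also have "\<dots> \<le> card ?C * \<delta>"
  proof (rule prob_Pi_pmf_union_bound[OF C(1)])
    fix e assume "e \<in> ?C"
    \<comment> \<open>\<open>card S < k\<close> keeps the enlarged set within \<open>k\<close>
      edges, where the sampling accuracy is guaranteed.\<close>
    then have "insert e S \<in> feasible V E A k"
      using net(3,4) card_insert_le_m1[of k S e] by (auto simp: feasible_def candidates_def)
    then have "1 - \<delta> \<le> measure_pmf.prob (?est e) {y. approximates lam y (?f (insert e S))}"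
      using samp by (simp add: accurate_sampling_def)
    moreover have "{y. \<not> approximates lam y (?f (insert e S))}
        = UNIV - {y. approximates lam y (?f (insert e S))}" by auto
    ultimately show "measure_pmf.prob (?est e) {y. \<not> approximates lam y (?f (insert e S))} \<le> \<delta>"
      using measure_pmf.prob_compl[of "{y. approximates lam y (?f (insert e S))}" "?est e"] by simp
  qed
  also have "\<dots> \<le> real (card V ^ 2) * \<delta>" using C(2) lam(2) by (intro mult_right_mono) auto
  finally show ?thesis .
qed

text \<open>A failure after round \<open>i + 1\<close> is either inherited from round
  \<open>i\<close> or produced by the next step from a good set, so each round adds at most
  \<open>card V ^ 2 * \<delta>\<close>.\<close>

lemma prob_greedy_fails:
  assumes net: "network V E p" "A \<subseteq> V"
    and lam: "0 < lam" "0 < \<delta>" and samp: "accurate_sampling V E p A k lam \<delta> R"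
    and pick: "maximizing_rule V E A pick"
    and "i \<le> k"
  shows "measure_pmf.prob (greedy V E p A R pick i)
      {T. \<not> greedy_ratio lam k i * OPT V E p A k \<le> influence V E p A T}
    \<le> real i * (real (card V ^ 2) * \<delta>)"
  using assms(7)
proof (induction i)
  case 0
  \<comment> \<open>\<open>greedy_ratio lam k 0 = 0\<close>, so the empty set meets the bound with
    certainty.\<close>
  then show ?case by (simp add: greedy_ratio_def influence_nonneg)
next
  case (Suc i)
  let ?G = "{T. greedy_ratio lam k i * OPT V E p A k \<le> influence V E p A T}"
  have "measure_pmf.prob (greedy V E p A R pick (Suc i))
      {T. \<not> greedy_ratio lam k (Suc i) * OPT V E p A k \<le> influence V E p A T}
      \<le> measure_pmf.prob (greedy V E p A R pick i) (- ?G) + real (card V ^ 2) * \<delta>"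
    unfolding greedy.simps
  proof (rule prob_bind_pmf_le)
    fix S assume "S \<in> set_pmf (greedy V E p A R pick i)" "S \<in> ?G"
    with greedy_feasible[OF pick this(1)] Suc.prems
    show "measure_pmf.prob (greedy_step V E p A R pick S)
        {T. \<not> greedy_ratio lam k (Suc i) * OPT V E p A k \<le> influence V E p A T}
        \<le> real (card V ^ 2) * \<delta>"
      by (intro prob_greedy_step_fails[OF net _ _ lam samp pick]) auto
  qed (use lam in simp)
  also have "- ?G = {T. \<not> greedy_ratio lam k i * OPT V E p A k \<le> influence V E p A T}" by auto
  also have "measure_pmf.prob (greedy V E p A R pick i) \<dots> \<le> real i * (real (card V ^ 2) * \<delta>)"
    using Suc by simp
  finally show ?case by (simp add: algebra_simps)
qed

section \<open>Choice of the accuracy and failure thresholds\<close>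

text \<open>The order of quantifiers fixes the dependencies: the accuracy threshold depends on
  \<open>\<epsilon>\<close> and \<open>k\<close>, the threshold for \<open>\<delta>\<close> also on
  the size bound \<open>n\<close> and the tolerated failure probability \<open>\<eta>\<close>,
  because the union bound counts up to \<open>k * n ^ 2\<close> estimates.\<close>

theorem theorem6:
  fixes \<epsilon> :: real and k :: nat
  assumes "\<epsilon> > 0"
  shows "\<exists>lam\<^sub>0 > 0. \<forall>(n :: nat) (\<eta> :: real). \<eta> > 0 \<longrightarrow> (\<exists>\<delta>\<^sub>0 > 0.
    \<forall>(V :: 'v set) E p A lam \<delta> R pick.
      network V E p \<and> card V \<le> n \<and> A \<subseteq> V \<and>
      0 < lam \<and> lam \<le> lam\<^sub>0 \<and> 0 < \<delta> \<and> \<delta> \<le> \<delta>\<^sub>0 \<and>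
      accurate_sampling V E p A k lam \<delta> R \<and> maximizing_rule V E A pick \<longrightarrow>
        (\<forall>S \<in> set_pmf (greedy V E p A R pick k). S \<subseteq> A \<times> V - E \<and> card S \<le> k) \<and>
        measure_pmf.prob (greedy V E p A R pick k)
          {S. influence V E p A S \<ge> (1 - 1 / exp 1 - \<epsilon>) * OPT V E p A k} \<ge> 1 - \<eta>)"
\<comment> \<open>Chosen so that \<open>2 * k * lam \<le> \<epsilon>\<close>, as
  \<open>greedy_ratio_ge\<close> demands; the \<open>+ 1\<close> keeps the denominator positive for
  \<open>k = 0\<close>.\<close>
proof (rule exI[of _ "\<epsilon> / (2 * real k + 1)"], intro conjI allI impI)
  show "0 < \<epsilon> / (2 * real k + 1)" using assms by simp
  fix n :: nat and \<eta> :: real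
  assume "0 < \<eta>"
  \<comment> \<open>Chosen so that \<open>k * n ^ 2 * \<delta> \<le> \<eta>\<close>; the
    \<open>+ 1\<close> again guards against a zero denominator.\<close>
  let ?\<delta> = "\<eta> / (real k * real (n ^ 2) + 1)"
  show "\<exists>\<delta>\<^sub>0 > 0. \<forall>(V :: 'v set) E p A lam \<delta> R pick.
      network V E p \<and> card V \<le> n \<and> A \<subseteq> V \<and>
      0 < lam \<and> lam \<le> \<epsilon> / (2 * real k + 1) \<and> 0 < \<delta> \<and> \<delta> \<le> \<delta>\<^sub>0 \<and>
      accurate_sampling V E p A k lam \<delta> R \<and> maximizing_rule V E A pick \<longrightarrow>
        (\<forall>S \<in> set_pmf (greedy V E p A R pick k). S \<subseteq> A \<times> V - E \<and> card S \<le> k) \<and>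
        measure_pmf.prob (greedy V E p A R pick k)
          {S. influence V E p A S \<ge> (1 - 1 / exp 1 - \<epsilon>) * OPT V E p A k} \<ge> 1 - \<eta>"
  proof (rule exI[of _ ?\<delta>], intro conjI allI impI; (elim conjE)?)
    have "0 < real k * real (n ^ 2) + 1" by (simp add: add_nonneg_pos)
    then show "0 < ?\<delta>" using \<open>0 < \<eta>\<close> by simp
    fix V :: "'v set" and E p A lam \<delta> R pick
    assume net: "network V E p" "A \<subseteq> V" and "card V \<le> n"
      and lam: "0 < lam" "lam \<le> \<epsilon> / (2 * real k + 1)" and \<delta>: "0 < \<delta>" "\<delta> \<le> ?\<delta>"
      and samp: "accurate_sampling V E p A k lam \<delta> R" and pick: "maximizing_rule V E A pick"
    show "\<forall>S \<in> set_pmf (greedy V E p A R pick k). S \<subseteq> A \<times> V - E \<and> card S \<le> k"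
      using greedy_feasible[OF pick] by blast
    let ?bound = "\<lambda>S. (1 - 1 / exp 1 - \<epsilon>) * OPT V E p A k \<le> influence V E p A S"
    let ?G = "greedy V E p A R pick k"
    show "1 - \<eta> \<le> measure_pmf.prob ?G {S. ?bound S}"
    \<comment> \<open>\<open>greedy_ratio lam 0 0\<close> is 0 and gives no useful bound, so
      \<open>k = 0\<close> is separate: only the empty set is feasible, and it is optimal.\<close>
    proof (cases "k = 0")
      case True
      have "feasible V E A 0 = {{}}"
      proof -
        have "finite (A \<times> V)" using net finite_subset by (auto simp: network_def)
        then have "S = {}" if "S \<subseteq> A \<times> V - E" "card S = 0" for S
          using that by (meson Diff_subset card_eq_0_iff finite_subset subset_trans)
        then show ?thesis by (auto simp: feasible_def)
      qed
      then have "OPT V E p A k = influence V E p A {}" using True by (simp add: OPT_def)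
      moreover have "1 - 1 / exp 1 - \<epsilon> \<le> 1"
      proof -
        have "0 \<le> 1 / exp (1 :: real)" by simp
        then show ?thesis using assms by linarith
      qed
      ultimately have "?bound {}"
        using mult_right_mono[OF _ influence_nonneg, of "1 - 1 / exp 1 - \<epsilon>" 1 V E p A "{}"] by simp
      then show ?thesis using True \<open>0 < \<eta>\<close> by simp
    next
      case False
      have "2 * k * lam \<le> (2 * k + 1) * lam" using lam(1) by (simp add: algebra_simps)
      also have "\<dots> \<le> \<epsilon>" using lam(2) by (simp add: field_simps)
      finally have ratio: "1 - 1 / exp 1 - \<epsilon> \<le> greedy_ratio lam k k"
        using False lam(1) by (intro greedy_ratio_ge) auto
      \<comment> \<open>Since \<open>OPT\<close> is non-negative, the larger ratio gives the
        stronger requirement, so missing the target implies missing it as well.\<close>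
      have "{S. \<not> ?bound S} \<subseteq> {T. \<not> greedy_ratio lam k k * OPT V E p A k \<le> influence V E p A T}"
        using mult_right_mono[OF ratio OPT_nonneg[OF net, of k]] by (auto intro: order_trans)
      then have "measure_pmf.prob ?G {S. \<not> ?bound S} \<le> measure_pmf.prob ?G
          {T. \<not> greedy_ratio lam k k * OPT V E p A k \<le> influence V E p A T}"
        by (intro measure_pmf.finite_measure_mono) auto
      also have "\<dots> \<le> real k * (real (card V ^ 2) * \<delta>)"
        by (rule prob_greedy_fails[OF net lam(1) \<delta>(1) samp pick order.refl])
      also have "\<dots> \<le> real k * (real (n ^ 2) * \<delta>)"
        using \<open>card V \<le> n\<close> \<delta>(1)
        by (intro mult_left_mono mult_right_mono) (auto intro: power_mono)
      also have "\<dots> \<le> (real k * real (n ^ 2) + 1) * \<delta>" using \<delta>(1) by (simp add: algebra_simps)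
      also have "\<dots> \<le> \<eta>"
        using \<delta>(2) \<open>0 < real k * real (n ^ 2) + 1\<close> by (simp add: pos_le_divide_eq mult.commute)
      finally have "measure_pmf.prob ?G {S. \<not> ?bound S} \<le> \<eta>" .
      moreover have "{S. \<not> ?bound S} = UNIV - {S. ?bound S}" by auto
      ultimately show ?thesis using measure_pmf.prob_compl[of "{S. ?bound S}" ?G] by simp
    qed
  qed
qed

end
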